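(* Let $(X,d)$ be a compact metric space with Borel $\sigma$-algebra $\mathcal B$, let $\mu$ be a $\delta$-Ahlfors regular Borel probability measure on $X$, and let $T_{\mathbb N}=\{t_n\}_{n\in\mathbb N}$ be a sequence of $\mu$-preserving transformations of $X$ which is uniformly mixing with respect to $\mu$; let $T_n=t_n\circ\cdots\circ t_1$. Let $\{r_n\}_{n\in\mathbb N}$ be a sequence of positive real numbers. If $\sum_{n=1}^\infty r_n^\delta<\infty$, then the recurrence set $$\mathcal R(T_{\mathbb N},\{r_n\}):=\{x\in X:T_n(x)\in B(x,r_n)\text{ for infinitely many }n\in\mathbb N\}$$ satisfies $\mu(\mathcal R(T_{\mathbb N},\{r_n\}))=0$.
   Context: $\mu$ is $\delta$-Ahlfors regular ($\delta>0$) if there are constants $c_1,c_2>0$ such that $c_1r^\delta\le\mu(B(x,r))\le c_2r^\delta$ for all $x\in X$ and $0<r\le1$. $T_{\mathbb N}$ is uniformly mixing with respect to $\mu$ if there is a function $\phi:\mathbb N\to(0,\infty)$ with $\sum_{n=1}^\infty\phi(n)<\infty$ such that for all integers $0\le m<n$, all balls $B\subset X$, and all $A\in\mathcal B$ with $\mu(A)>0$, $$\left|\frac{\mu\bigl(B\cap(t_n\circ\cdots\circ t_{m+1})^{-1}(A)\bigr)}{\mu(A)}-\mu(B)\right|\le\phi(n-m).$$ *)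

theory Defs
  imports "HOL-Probability.Probability"
begin

definition ahlfors_regular :: "real \<Rightarrow> 'a::metric_space measure \<Rightarrow> bool" where
  "ahlfors_regular \<delta> M \<longleftrightarrow> \<delta> > 0 \<and>
     (\<exists>c1>0. \<exists>c2>0. \<forall>x r. 0 < r \<and> r \<le> 1 \<longrightarrow>
        c1 * r powr \<delta> \<le> measure M (ball x r) \<and> measure M (ball x r) \<le> c2 * r powr \<delta>)"

definition preserves_measure :: "'a measure \<Rightarrow> ('a \<Rightarrow> 'a) \<Rightarrow> bool" where
  "preserves_measure M f \<longleftrightarrow> f \<in> measurable M M \<and>
     (\<forall>A\<in>sets M. emeasure M (f -` A \<inter> space M) = emeasure M A)"

text \<open>For \<open>m \<le> n\<close>, \<open>comp_seq t m n\<close> is \<open>t n \<circ> \<dots> \<circ> t (m + 1)\<close>, the identity if \<open>m = n\<close>.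
  Sequences are indexed by the positive integers; values at index 0 play no role.\<close>

fun comp_seq :: "(nat \<Rightarrow> 'a \<Rightarrow> 'a) \<Rightarrow> nat \<Rightarrow> nat \<Rightarrow> 'a \<Rightarrow> 'a" where
  "comp_seq t m 0 = id"
| "comp_seq t m (Suc n) = (if m \<le> n then t (Suc n) \<circ> comp_seq t m n else id)"

definition uniformly_mixing :: "'a::metric_space measure \<Rightarrow> (nat \<Rightarrow> 'a \<Rightarrow> 'a) \<Rightarrow> bool" where
  "uniformly_mixing M t \<longleftrightarrow>
     (\<exists>\<phi> :: nat \<Rightarrow> real. (\<forall>n\<ge>1. \<phi> n > 0) \<and> summable (\<lambda>n. \<phi> (Suc n)) \<and>
        (\<forall>m n x \<rho>. \<forall>A\<in>sets M. m < n \<and> \<rho> > 0 \<and> measure M A > 0 \<longrightarrow>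
           \<bar>measure M (ball x \<rho> \<inter> comp_seq t m n -` A) / measure M A - measure M (ball x \<rho>)\<bar>
             \<le> \<phi> (n - m)))"

definition recurrence_set :: "(nat \<Rightarrow> 'a::metric_space \<Rightarrow> 'a) \<Rightarrow> (nat \<Rightarrow> real) \<Rightarrow> 'a set" where
  "recurrence_set t r = {x. infinite {n. n \<ge> 1 \<and> comp_seq t 0 n x \<in> ball x (r n)}}"

end

theory Submission
  imports Defs
begin

text \<open>Let \<open>E n\<close> be the set of \<open>x\<close> with \<open>T n x \<in> B(x, r n)\<close>. A maximal \<open>r n\<close>-separated set \<open>S\<close> has
  at most a constant times \<open>r n powr - \<delta>\<close> elements, and the balls of radius \<open>r n\<close> around it cover
  the space. On such a ball with centre \<open>q\<close> a point of \<open>E n\<close> is sent by \<open>T n\<close> into \<open>B(q, 2 * r n)\<close>,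
  which by mixing happens with probability at most
  \<open>\<mu>(B(q, 2 * r n)) * (\<mu>(B(q, r n)) + \<phi> n)\<close>. Summing over \<open>S\<close> bounds \<open>\<mu>(E n)\<close> by a constant times
  \<open>r n powr \<delta> + \<phi> n\<close>, and the Borel-Cantelli lemma applies.\<close>

text \<open>Balls of radius \<open>e / 2\<close> around \<open>e\<close>-separated points are
  disjoint and each has mass at least \<open>c\<close>, so total mass 1 allows at most
  \<open>1 / c\<close> points. A separated set of greatest cardinality therefore exists, and its
  maximality makes it an \<open>e\<close>-net.\<close>

lemma separated_net_bounded_card:
  fixes M :: "'a::metric_space measure"
  assumes "prob_space M" and sets: "sets M = sets borel"
    and "c > 0" and lower: "\<And>x. c \<le> measure M (ball x (e / 2))"
  obtains S :: "'a set" where "finite S" "real (card S) * c \<le> 1" "\<And>x. \<exists>q\<in>S. dist q x < e"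
proof -
  interpret prob_space M by fact
  define sep where "sep S \<longleftrightarrow> finite S \<and> (\<forall>p\<in>S. \<forall>q\<in>S. p \<noteq> q \<longrightarrow> e \<le> dist p q)" for S :: "'a set"
  have bound: "real (card S) * c \<le> 1" if "sep S" for S
  proof -
    have disj: "disjoint_family_on (\<lambda>q. ball q (e / 2)) S"
      unfolding disjoint_family_on_def
    proof (intro ballI impI)
      fix p q assume "p \<in> S" "q \<in> S" "p \<noteq> q"
      then have "e \<le> dist p q" using that by (simp add: sep_def)
      then show "ball p (e / 2) \<inter> ball q (e / 2) = {}"
        by (intro disjoint_ballI) simp
    qed
    have "real (card S) * c \<le> (\<Sum>q\<in>S. measure M (ball q (e / 2)))"
      using sum_mono[of S "\<lambda>_. c"] lower by simp
    also have "\<dots> = measure M (\<Union>q\<in>S. ball q (e / 2))"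
      using that disj by (intro finite_measure_finite_Union[symmetric]) (auto simp: sep_def sets)
    also have "\<dots> \<le> 1" by (rule prob_le_1)
    finally show ?thesis .
  qed
  have "\<forall>S. sep S \<longrightarrow> card S < Suc (nat \<lceil>1 / c\<rceil>)"
  proof (intro allI impI)
    fix S assume "sep S"
    then have "real (card S) \<le> 1 / c" using bound \<open>c > 0\<close> by (simp add: field_simps)
    then show "card S < Suc (nat \<lceil>1 / c\<rceil>)" by linarith
  qed
  moreover have "sep {}" by (simp add: sep_def)
  ultimately obtain S where S: "sep S" and max: "\<And>S'. sep S' \<Longrightarrow> card S' \<le> card S"
    using ex_has_greatest_nat[of sep "{}" card] by blast
  have "\<exists>q\<in>S. dist q x < e" for x
  proof (rule ccontr)
    assume far: "\<not> ?thesis"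
    \<comment> \<open>A ball of nonpositive radius is empty and cannot have mass \<open>c\<close>.
      Positivity gives \<open>dist x x < e\<close>, so the uncovered point \<open>x\<close> lies
      outside \<open>S\<close> and inserting it really enlarges the separated set.\<close>
    have "e > 0"
    proof (rule ccontr)
      assume "\<not> e > 0"
      then have empty: "ball x (e / 2) = {}" by simp
      show False using lower[of x] \<open>c > 0\<close> unfolding empty by simp
    qed
    have "x \<notin> S" using far \<open>e > 0\<close> by force
    moreover have "sep (insert x S)"
      using S far by (force simp: sep_def not_less dist_commute)
    ultimately show False using max[of "insert x S"] S by (simp add: sep_def)
  qed
  moreover have "finite S" using S by (simp add: sep_def)
  ultimately show thesis using bound[OF S] by (intro that[of S])
qed

text \<open>Finite nets at the scales \<open>1 / Suc k\<close> write the set as a countable union of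
  sets \<open>ball q (e k)\<close> intersected with preimages of balls, all of them
  measurable.\<close>

lemma displacement_less_measurable:
  fixes M :: "'a::metric_space measure"
  assumes sets: "sets M = sets borel"
    and f: "f \<in> measurable M M"
    and nets: "\<And>e::real. e > 0 \<Longrightarrow> \<exists>S. finite S \<and> (\<forall>x::'a. \<exists>q\<in>S. dist q x < e)"
  shows "{x. dist x (f x) < \<rho>} \<in> sets M"
proof -
  have space: "space M = UNIV" using sets_eq_imp_space_eq[OF sets] by simp
  define e :: "nat \<Rightarrow> real" where "e k = 1 / Suc k" for k
  have "\<exists>S. finite S \<and> (\<forall>x::'a. \<exists>q\<in>S. dist q x < e k)" for k
    by (rule nets) (simp add: e_def)
  then obtain S :: "nat \<Rightarrow> 'a set"
    where fin: "\<And>k. finite (S k)" and S: "\<And>k x. \<exists>q\<in>S k. dist q x < e k"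
    by metis
  have eq: "{x. dist x (f x) < \<rho>} = (\<Union>k. \<Union>q\<in>S k. ball q (e k) \<inter> (f -` ball q (\<rho> - e k) \<inter> space M))"
  proof (intro equalityI subsetI)
    fix x assume "x \<in> {x. dist x (f x) < \<rho>}"
    then have "0 < (\<rho> - dist x (f x)) / 2" by simp
    then obtain k where "inverse (real (Suc k)) < (\<rho> - dist x (f x)) / 2"
      using reals_Archimedean by blast
    \<comment> \<open>One \<open>e k\<close> pays for the move from \<open>x\<close> to its net
      point \<open>q\<close>, the other for the shrunken radius \<open>\<rho> - e k\<close>.\<close>
    then have k: "2 * e k < \<rho> - dist x (f x)" by (simp add: e_def inverse_eq_divide)
    obtain q where q: "q \<in> S k" "dist q x < e k" using S by blast
    have "dist q (f x) < \<rho> - e k"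
      using k q(2) dist_triangle[of q "f x" x] by linarith
    then show "x \<in> (\<Union>k. \<Union>q\<in>S k. ball q (e k) \<inter> (f -` ball q (\<rho> - e k) \<inter> space M))"
      using q by (auto simp: space)
  next
    fix x assume "x \<in> (\<Union>k. \<Union>q\<in>S k. ball q (e k) \<inter> (f -` ball q (\<rho> - e k) \<inter> space M))"
    then obtain k q where "dist q x < e k" "dist q (f x) < \<rho> - e k" by auto
    then show "x \<in> {x. dist x (f x) < \<rho>}"
      using dist_triangle[of x "f x" q] by (simp add: dist_commute)
  qed
  have preimage: "f -` ball q s \<inter> space M \<in> sets M" for q s
    using f by (rule measurable_sets) (simp add: sets)
  have "(\<Union>q\<in>S k. ball q (e k) \<inter> (f -` ball q (\<rho> - e k) \<inter> space M)) \<in> sets M" for k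
    by (intro sets.finite_UN sets.Int[OF _ preimage] fin) (simp add: sets)
  then show ?thesis unfolding eq by blast
qed

lemma comp_seq_measurable:
  assumes "\<And>n. n \<ge> 1 \<Longrightarrow> t n \<in> measurable M M"
  shows "comp_seq t m n \<in> measurable M M"
  by (induction n) (auto simp: id_def intro!: measurable_comp[where N = M] assms)

text \<open>This is the estimate for a single time: \<open>f\<close> stands for \<open>T n\<close>,
  \<open>p\<close> for \<open>\<phi> n\<close>, and \<open>mix\<close> is the upper half of the
  mixing inequality. The bound \<open>\<rho> \<le> 1 / 2\<close> keeps the doubled radius
  \<open>2 * \<rho>\<close> within the range of the Ahlfors bounds.\<close>

lemma measure_displacement_less_le:
  fixes M :: "'a::metric_space measure"
  assumes "prob_space M" and sets: "sets M = sets borel"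
    and f: "f \<in> measurable M M"
    and "c1 > 0" and "0 < \<rho>" and "\<rho> \<le> 1 / 2" and "p \<ge> 0"
    and lower: "\<And>x s. 0 < s \<Longrightarrow> s \<le> 1 \<Longrightarrow> c1 * s powr \<delta> \<le> measure M (ball x s)"
    and upper: "\<And>x s. 0 < s \<Longrightarrow> s \<le> 1 \<Longrightarrow> measure M (ball x s) \<le> c2 * s powr \<delta>"
    and mix: "\<And>x s A. s > 0 \<Longrightarrow> A \<in> sets M \<Longrightarrow> measure M A > 0 \<Longrightarrow>
      measure M (ball x s \<inter> f -` A) / measure M A \<le> measure M (ball x s) + p"
  shows "measure M {x. dist x (f x) < \<rho>} \<le> 4 powr \<delta> * c2 / c1 * (c2 * \<rho> powr \<delta> + p)"
proof -
  interpret prob_space M by fact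
  have space: "space M = UNIV" using sets_eq_imp_space_eq[OF sets] by simp
  define c where "c = c1 * (\<rho> / 2) powr \<delta>"
  have "c > 0" using assms by (simp add: c_def)
  have "c \<le> measure M (ball x (\<rho> / 2))" for x
    unfolding c_def using assms by (intro lower) auto
  then obtain S :: "'a set" where S: "finite S" "real (card S) * c \<le> 1" "\<And>x. \<exists>q\<in>S. dist q x < \<rho>"
    using separated_net_bounded_card[OF \<open>prob_space M\<close> sets \<open>c > 0\<close>] by metis
  define D where "D = (c2 * (2 * \<rho>) powr \<delta>) * (c2 * \<rho> powr \<delta> + p)"
  define U where "U q = ball q \<rho> \<inter> f -` ball q (2 * \<rho>)" for q
  have "f -` ball q s \<inter> space M \<in> sets M" for q s
    using f by (rule measurable_sets) (simp add: sets)
  then have U_sets: "U q \<in> sets M" for q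
    unfolding U_def by (intro sets.Int) (auto simp: sets space)
  have U_le: "measure M (U q) \<le> D" for q
  proof -
    let ?B = "ball q (2 * \<rho>)"
    have pos: "0 < measure M ?B"
      using assms by (intro less_le_trans[OF _ lower]) auto
    \<comment> \<open>Dividing by the positive mass of the target ball exposes the ratio that
      \<open>mix\<close> controls.\<close>
    have "measure M (U q) = measure M ?B * (measure M (U q) / measure M ?B)"
      using pos by simp
    also have "\<dots> \<le> measure M ?B * (measure M (ball q \<rho>) + p)"
      unfolding U_def using pos \<open>0 < \<rho>\<close> by (intro mult_left_mono mix) (auto simp: sets)
    also have "\<dots> \<le> D"
    proof -
      have "measure M ?B \<le> c2 * (2 * \<rho>) powr \<delta>" "measure M (ball q \<rho>) \<le> c2 * \<rho> powr \<delta>"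
        using \<open>0 < \<rho>\<close> \<open>\<rho> \<le> 1 / 2\<close> by (auto intro: upper)
      then show ?thesis
        unfolding D_def using pos \<open>p \<ge> 0\<close> by (intro mult_mono) auto
    qed
    finally show ?thesis .
  qed
  then have "D \<ge> 0" using measure_nonneg order_trans by blast
  have "{x. dist x (f x) < \<rho>} \<subseteq> (\<Union>q\<in>S. U q)"
  proof
    fix x assume x: "x \<in> {x. dist x (f x) < \<rho>}"
    obtain q where q: "q \<in> S" "dist q x < \<rho>" using S(3) by blast
    then have "dist q (f x) < 2 * \<rho>" using x dist_triangle[of q "f x" x] by simp
    then show "x \<in> (\<Union>q\<in>S. U q)" using q by (auto simp: U_def)
  qed
  then have "measure M {x. dist x (f x) < \<rho>} \<le> measure M (\<Union>q\<in>S. U q)"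
    using S(1) U_sets by (intro finite_measure_mono) auto
  also have "\<dots> \<le> (\<Sum>q\<in>S. measure M (U q))"
    using S(1) U_sets by (intro finite_measure_subadditive_finite) auto
  also have "\<dots> \<le> real (card S) * D" using U_le by (simp add: sum_bounded_above)
  also have "\<dots> \<le> 1 / c * D"
    using S(2) \<open>c > 0\<close> \<open>D \<ge> 0\<close> by (intro mult_right_mono) (auto simp: field_simps)
  also have "\<dots> = 4 powr \<delta> * c2 / c1 * (c2 * \<rho> powr \<delta> + p)"
  proof -
    \<comment> \<open>The factor \<open>4 powr \<delta>\<close> compares the target radius
      \<open>2 * \<rho>\<close> with the packing radius \<open>\<rho> / 2\<close>; the powers of
      \<open>\<rho>\<close> then cancel against \<open>c\<close>.\<close>
    have "(2 * \<rho>) powr \<delta> = 4 powr \<delta> * (\<rho> / 2) powr \<delta>"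
      using \<open>0 < \<rho>\<close> by (simp flip: powr_mult)
    then show ?thesis using \<open>c1 > 0\<close> \<open>0 < \<rho>\<close> by (simp add: c_def D_def)
  qed
  finally show ?thesis .
qed

theorem theorem4:
  fixes M :: "'a::metric_space measure"
    and \<delta> :: real
    and t :: "nat \<Rightarrow> 'a \<Rightarrow> 'a"
    and r :: "nat \<Rightarrow> real"
  assumes "compact (UNIV :: 'a set)"
    and "prob_space M"
    and "sets M = sets borel"
    and "ahlfors_regular \<delta> M"
    and "\<And>n. n \<ge> 1 \<Longrightarrow> preserves_measure M (t n)"
    and "uniformly_mixing M t"
    and "\<And>n. n \<ge> 1 \<Longrightarrow> r n > 0"
    and "summable (\<lambda>n. r (Suc n) powr \<delta>)"
  shows "recurrence_set t r \<in> null_sets M"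
proof -
  interpret prob_space M by fact
  obtain c1 c2 where "\<delta> > 0" "c1 > 0"
    and lower: "\<And>x s. 0 < s \<Longrightarrow> s \<le> 1 \<Longrightarrow> c1 * s powr \<delta> \<le> measure M (ball x s)"
    and upper: "\<And>x s. 0 < s \<Longrightarrow> s \<le> 1 \<Longrightarrow> measure M (ball x s) \<le> c2 * s powr \<delta>"
    using assms(4) unfolding ahlfors_regular_def by blast
  obtain \<phi> :: "nat \<Rightarrow> real" where \<phi>: "\<And>n. n \<ge> 1 \<Longrightarrow> \<phi> n > 0" "summable (\<lambda>n. \<phi> (Suc n))"
    and mix: "\<And>m n x \<rho> A. A \<in> sets M \<Longrightarrow> m < n \<Longrightarrow> \<rho> > 0 \<Longrightarrow> measure M A > 0 \<Longrightarrow>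
      \<bar>measure M (ball x \<rho> \<inter> comp_seq t m n -` A) / measure M A - measure M (ball x \<rho>)\<bar> \<le> \<phi> (n - m)"
    using assms(6) unfolding uniformly_mixing_def by blast
  have T: "comp_seq t 0 n \<in> measurable M M" for n
    using assms(5) by (intro comp_seq_measurable) (auto simp: preserves_measure_def)
  have nets: "\<exists>S. finite S \<and> (\<forall>x::'a. \<exists>q\<in>S. dist q x < e)" if "e > 0" for e :: real
    using compact_eq_totally_bounded[of "UNIV :: 'a set"] assms(1) that by (force simp: subset_iff)
  \<comment> \<open>The index is shifted: \<open>E n\<close> is the event at time
    \<open>Suc n\<close>, since times start at 1.\<close>
  define E where "E n = {x. dist x (comp_seq t 0 (Suc n) x) < r (Suc n)}" for n
  have E_sets: "E n \<in> sets M" for n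
    unfolding E_def by (rule displacement_less_measurable[OF assms(3) T nets])
  define C where "C = 4 powr \<delta> * c2 / c1"
  have bound: "measure M (E n) \<le> C * (c2 * r (Suc n) powr \<delta> + \<phi> (Suc n))" if "r (Suc n) \<le> 1 / 2" for n
    unfolding C_def E_def
  proof (rule measure_displacement_less_le[OF assms(2,3) T \<open>c1 > 0\<close> _ that _ lower upper])
    show "measure M (ball x s \<inter> comp_seq t 0 (Suc n) -` A) / measure M A
        \<le> measure M (ball x s) + \<phi> (Suc n)"
      if "s > 0" "A \<in> sets M" "measure M A > 0" for x s A
      \<comment> \<open>Mixing is used from time 0, so the error is
        \<open>\<phi> (Suc n - 0)\<close>; \<open>comp_seq\<close> stays folded to match the
        goal.\<close>
      using mix[of A 0 "Suc n" s x] that by (simp del: comp_seq.simps)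
  qed (use assms(7) \<phi>(1)[of "Suc n"] in \<open>auto simp: less_imp_le\<close>)
  \<comment> \<open>Summability sends \<open>r (Suc n) powr \<delta>\<close> to 0. As
    \<open>\<delta> > 0\<close>, the radii are eventually at most \<open>1 / 2\<close>, and
    \<open>bound\<close> applies to all but finitely many events.\<close>
  have "eventually (\<lambda>n. r (Suc n) powr \<delta> < (1 / 2) powr \<delta>) sequentially"
    using summable_LIMSEQ_zero[OF assms(8)] by (rule order_tendstoD) simp
  then have small: "eventually (\<lambda>n. r (Suc n) \<le> 1 / 2) sequentially"
  proof eventually_elim
    case (elim n)
    then show ?case
      using powr_mono2[of \<delta> "1 / 2" "r (Suc n)"] \<open>\<delta> > 0\<close> by linarith
  qed
  have "summable (\<lambda>n. measure M (E n))"
  proof (rule summable_comparison_test_ev)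
    show "eventually (\<lambda>n. norm (measure M (E n)) \<le> C * (c2 * r (Suc n) powr \<delta> + \<phi> (Suc n))) sequentially"
      using small by eventually_elim (simp add: bound)
    show "summable (\<lambda>n. C * (c2 * r (Suc n) powr \<delta> + \<phi> (Suc n)))"
      by (intro summable_mult summable_add assms(8) \<phi>(2))
  qed
  then have "limsup E \<in> null_sets M"
    using E_sets by (intro borel_cantelli_limsup1) (auto simp: less_top[symmetric])
  moreover have "recurrence_set t r = limsup E"
  proof (intro set_eqI)
    fix x
    let ?P = "\<lambda>n. comp_seq t 0 n x \<in> ball x (r n)"
    \<comment> \<open>Reindexing by the injective \<open>Suc\<close> preserves infinitude and
      matches the shift in \<open>E\<close>.\<close>
    have "{n. n \<ge> 1 \<and> ?P n} = Suc ` {n. ?P (Suc n)}"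
      by (auto simp: image_iff Suc_le_eq gr0_conv_Suc simp del: comp_seq.simps)
    then have "infinite {n. n \<ge> 1 \<and> ?P n} \<longleftrightarrow> infinite {n. ?P (Suc n)}"
      by (simp add: finite_image_iff del: comp_seq.simps)
    moreover have "x \<in> limsup E \<longleftrightarrow> infinite {n. x \<in> E n}"
      unfolding mem_limsup_iff
      by (simp only: cofinite_eq_sequentially[symmetric] frequently_cofinite)
    ultimately show "x \<in> recurrence_set t r \<longleftrightarrow> x \<in> limsup E"
      by (simp add: recurrence_set_def E_def del: comp_seq.simps)
  qed
  ultimately show ?thesis by simp
qed

end
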